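(* Let $(\mathcal{C},F)$ be a generalized network code whose generalized network channel $F$ is error-linear. Then $D_0=D_1=D_2$ on $\mathcal{C}\times\mathcal{C}$, and they are all metrics on $\mathcal{C}$.
   Context: A generalized network channel consists of a set $\mathcal{C}$ of codewords, a set $\mathcal{E}$ of errors with a distinguished element $0$ (the zero error), an output set $\mathcal{Y}$, a weight $w:\mathcal{E}\to\mathbb{Z}_{\ge 0}$ with $w(z)=0$ if and only if $z=0$, and a transfer function $F:\mathcal{C}\times\mathcal{E}\to\mathcal{Y}$ such that $F(x,0)\ne F(x',0)$ whenever $x\neq x'$ in $\mathcal{C}$. The sets are otherwise arbitrary. The pair $(\mathcal{C},F)$ is called a generalized network code; $|\mathcal{C}|\ge 2$ is assumed. The channel $F$ is called error-linear if: (i) $\mathcal{E}$ is a (not necessarily abelian) group with operation $\circ$ and identity $0$; (ii) $\mathcal{Y}$ is an abelian group with operation $\oplus$ and identity $0$; (iii) $F(x,z)=f(x)\oplus h(z)$ for some function $f:\mathcal{C}\to\mathcal{Y}$ and some group homomorphism $h:\mathcal{E}\to\mathcal{Y}$; (iv) $w(z\circ z')\le w(z)+w(z')$ for all $z,z'\in\mathcal{E}$; (v) $w(z^{-1})=w(z)$ for all $z\in\mathcal{E}$; (vi) for every $z\in\mathcal{E}$ and integers $c_1,c_2\ge 0$ with $c_1+c_2=w(z)$ there exist $z_1,z_2\in\mathcal{E}$ with $w(z_1)=c_1$, $w(z_2)=c_2$ and $z_1\circ z_2=z$. For $x\in\mathcal{C}$ and an integer $c\ge 0$, the decoding ball is $\Phi(x,c)=\{F(x,z):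 z\in\mathcal{E},\ w(z)\le c\}$. For $x_1,x_2\in\mathcal{C}$ (all $c$'s are nonnegative integers): $D_0(x_1,x_2)=\min\{c_1+c_2 : |c_1-c_2|\le 1,\ \Phi(x_1,c_1)\cap\Phi(x_2,c_2)\ne\emptyset\}$; $D_1(x_1,x_2)=\min\{c : \Phi(x_1,0)\cap\Phi(x_2,c)\neq\emptyset\}$; $D_2(x_1,x_2)=\min\{c_1+c_2 : \Phi(x_1,c_1)\cap\Phi(x_2,c_2)\neq\emptyset\}$. It is assumed that these minima exist, i.e. the distances are finite, for all $x_1,x_2\in\mathcal{C}$. A metric on a set $M$ is a function $D:M\times M\to\mathbb{R}$ with $D(x,y)\ge 0$ and equality iff $x=y$, $D(x,y)=D(y,x)$, and $D(x,y)+D(y,z)\ge D(x,z)$. *)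

theory Defs
  imports "HOL-Analysis.Analysis" "HOL-Algebra.Group"
begin

locale generalized_network_channel =
  fixes C :: "'c set" and E :: "'e set" and e0 :: 'e and Y :: "'y set"
    and w :: "'e \<Rightarrow> nat" and F :: "'c \<Rightarrow> 'e \<Rightarrow> 'y"
  assumes zero_error: "e0 \<in> E"
    and transfer: "\<And>x z. x \<in> C \<Longrightarrow> z \<in> E \<Longrightarrow> F x z \<in> Y"
    and weight_zero_iff: "\<And>z. z \<in> E \<Longrightarrow> w z = 0 \<longleftrightarrow> z = e0"
    and error_free_distinct: "\<And>x x'. x \<in> C \<Longrightarrow> x' \<in> C \<Longrightarrow> x \<noteq> x' \<Longrightarrow> F x e0 \<noteq> F x' e0"

text \<open>The condition that C has at least two elements is not stated with \<open>card\<close>,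
  because C may be infinite.\<close>

locale generalized_network_code = generalized_network_channel +
  assumes two_codewords: "\<exists>x\<in>C. \<exists>x'\<in>C. x \<noteq> x'"

definition decoding_ball ::
  "'e set \<Rightarrow> ('e \<Rightarrow> nat) \<Rightarrow> ('c \<Rightarrow> 'e \<Rightarrow> 'y) \<Rightarrow> 'c \<Rightarrow> nat \<Rightarrow> 'y set" where
  "decoding_ball E w F x c = {F x z | z. z \<in> E \<and> w z \<le> c}"

text \<open>The sets of natural numbers whose minima are the three distances. They may be
  infinite, so the minima are taken with \<open>LEAST\<close>; these are meaningful only if the sets
  are nonempty, which is what \<open>finite_distances\<close> below expresses.\<close>

definition D0_set ::
  "'e set \<Rightarrow> ('e \<Rightarrow> nat) \<Rightarrow> ('c \<Rightarrow> 'e \<Rightarrow> 'y) \<Rightarrow> 'c \<Rightarrow> 'c \<Rightarrow> nat set" where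
  "D0_set E w F x1 x2 = {c1 + c2 | c1 c2. \<bar>int c1 - int c2\<bar> \<le> 1 \<and>
     decoding_ball E w F x1 c1 \<inter> decoding_ball E w F x2 c2 \<noteq> {}}"

definition D1_set ::
  "'e set \<Rightarrow> ('e \<Rightarrow> nat) \<Rightarrow> ('c \<Rightarrow> 'e \<Rightarrow> 'y) \<Rightarrow> 'c \<Rightarrow> 'c \<Rightarrow> nat set" where
  "D1_set E w F x1 x2 = {c. decoding_ball E w F x1 0 \<inter> decoding_ball E w F x2 c \<noteq> {}}"

definition D2_set ::
  "'e set \<Rightarrow> ('e \<Rightarrow> nat) \<Rightarrow> ('c \<Rightarrow> 'e \<Rightarrow> 'y) \<Rightarrow> 'c \<Rightarrow> 'c \<Rightarrow> nat set" where
  "D2_set E w F x1 x2 = {c1 + c2 | c1 c2.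
     decoding_ball E w F x1 c1 \<inter> decoding_ball E w F x2 c2 \<noteq> {}}"

definition D0 ::
  "'e set \<Rightarrow> ('e \<Rightarrow> nat) \<Rightarrow> ('c \<Rightarrow> 'e \<Rightarrow> 'y) \<Rightarrow> 'c \<Rightarrow> 'c \<Rightarrow> nat" where
  "D0 E w F x1 x2 = (LEAST d. d \<in> D0_set E w F x1 x2)"

definition D1 ::
  "'e set \<Rightarrow> ('e \<Rightarrow> nat) \<Rightarrow> ('c \<Rightarrow> 'e \<Rightarrow> 'y) \<Rightarrow> 'c \<Rightarrow> 'c \<Rightarrow> nat" where
  "D1 E w F x1 x2 = (LEAST d. d \<in> D1_set E w F x1 x2)"

definition D2 ::
  "'e set \<Rightarrow> ('e \<Rightarrow> nat) \<Rightarrow> ('c \<Rightarrow> 'e \<Rightarrow> 'y) \<Rightarrow> 'c \<Rightarrow> 'c \<Rightarrow> nat" where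
  "D2 E w F x1 x2 = (LEAST d. d \<in> D2_set E w F x1 x2)"

definition finite_distances ::
  "'c set \<Rightarrow> 'e set \<Rightarrow> ('e \<Rightarrow> nat) \<Rightarrow> ('c \<Rightarrow> 'e \<Rightarrow> 'y) \<Rightarrow> bool" where
  "finite_distances C E w F \<longleftrightarrow> (\<forall>x1\<in>C. \<forall>x2\<in>C.
     D0_set E w F x1 x2 \<noteq> {} \<and> D1_set E w F x1 x2 \<noteq> {} \<and> D2_set E w F x1 x2 \<noteq> {})"

text \<open>G is the (not necessarily abelian) group structure on the error set E, with the zero
  error as its identity; A is the abelian group structure on the output set Y, written
  multiplicatively as everywhere in HOL-Algebra.\<close>

locale error_linear_channel = generalized_network_channel C E e0 Y w F
  for C :: "'c set" and E :: "'e set" and e0 :: 'e and Y :: "'y set"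
    and w :: "'e \<Rightarrow> nat" and F :: "'c \<Rightarrow> 'e \<Rightarrow> 'y" +
  fixes G :: "('e, 'm) monoid_scheme" and A :: "('y, 'n) monoid_scheme"
  assumes error_group: "group G" "carrier G = E" "\<one>\<^bsub>G\<^esub> = e0"
    and output_group: "comm_group A" "carrier A = Y"
    and transfer_linear: "\<exists>f h. f \<in> C \<rightarrow> carrier A \<and> h \<in> hom G A \<and>
          (\<forall>x\<in>C. \<forall>z\<in>E. F x z = f x \<otimes>\<^bsub>A\<^esub> h z)"
    and weight_subadditive: "\<And>z z'. z \<in> E \<Longrightarrow> z' \<in> E \<Longrightarrow> w (z \<otimes>\<^bsub>G\<^esub> z') \<le> w z + w z'"
    and weight_inv: "\<And>z. z \<in> E \<Longrightarrow> w (inv\<^bsub>G\<^esub> z) = w z"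
    and weight_split: "\<And>z c1 c2. z \<in> E \<Longrightarrow> c1 + c2 = w z \<Longrightarrow>
          \<exists>z1\<in>E. \<exists>z2\<in>E. w z1 = c1 \<and> w z2 = c2 \<and> z1 \<otimes>\<^bsub>G\<^esub> z2 = z"

text \<open>The library locale \<open>Metric_space\<close> demands nonnegativity and symmetry on the whole
  type. Here the axioms are restricted to the set M, so the two notions
  agree up to changing D outside M, as the lemma shows.\<close>

definition metric_on :: "'a set \<Rightarrow> ('a \<Rightarrow> 'a \<Rightarrow> real) \<Rightarrow> bool" where
  "metric_on M D \<longleftrightarrow>
     (\<forall>x\<in>M. \<forall>y\<in>M. D x y \<ge> 0 \<and> (D x y = 0 \<longleftrightarrow> x = y)) \<and>
     (\<forall>x\<in>M. \<forall>y\<in>M. D x y = D y x) \<and>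
     (\<forall>x\<in>M. \<forall>y\<in>M. \<forall>z\<in>M. D x y + D y z \<ge> D x z)"

lemma metric_on_iff_Metric_space:
  "metric_on M D \<longleftrightarrow> Metric_space M (\<lambda>x y. if x \<in> M \<and> y \<in> M then D x y else 0)"
  unfolding metric_on_def Metric_space_def by (auto split: if_splits)

end

(* For an error-linear channel the sets whose minima define the three distances coincide.
   If F x1 z1 = F x2 z2, translating both errors by the inverse of z1 turns this collision
   into one with zero error at x1 and an error of weight at most w z1 + w z2 at x2.
   Conversely, such an error z can be split into two halves of nearly equal weight, one of
   which is moved back to x1. Symmetry is then evident from D2, and the
   triangle inequality follows from subadditivity of the weight. *)
theory Submission
  imports Defs
begin

lemma ball_Int_nonempty_iff:
  "decoding_ball E w F x1 c1 \<inter> decoding_ball E w F x2 c2 \<noteq> {} \<longleftrightarrow>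
     (\<exists>z1\<in>E. \<exists>z2\<in>E. w z1 \<le> c1 \<and> w z2 \<le> c2 \<and> F x1 z1 = F x2 z2)"
  unfolding decoding_ball_def by blast

lemma D0_set_subset_D2_set: "D0_set E w F x1 x2 \<subseteq> D2_set E w F x1 x2"
  unfolding D0_set_def D2_set_def by blast

lemma D2_set_commute: "D2_set E w F x1 x2 = D2_set E w F x2 x1"
proof -
  have "D2_set E w F x y \<subseteq> D2_set E w F y x" for x y
  proof
    fix d assume "d \<in> D2_set E w F x y"
    then obtain c1 c2 where "d = c1 + c2"
      and "decoding_ball E w F x c1 \<inter> decoding_ball E w F y c2 \<noteq> {}"
      unfolding D2_set_def by blast
    then have "d = c2 + c1" "decoding_ball E w F y c2 \<inter> decoding_ball E w F x c1 \<noteq> {}"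
      by (simp_all add: Int_commute)
    then show "d \<in> D2_set E w F y x"
      unfolding D2_set_def by blast
  qed
  then show ?thesis
    by blast
qed

text \<open>A ball of radius 0 contains only the error-free output, because \<open>e0\<close> is the
  only error of weight 0.\<close>

lemma (in generalized_network_channel) mem_D1_set_iff:
  "c \<in> D1_set E w F x1 x2 \<longleftrightarrow> (\<exists>z\<in>E. w z \<le> c \<and> F x1 e0 = F x2 z)"
  unfolding D1_set_def mem_Collect_eq ball_Int_nonempty_iff
  using zero_error weight_zero_iff by auto

text \<open>Radius 0 on both sides leaves only error-free outputs, and these separate codewords.
  This gives the metric axiom that distance 0 means equality.\<close>

lemma (in generalized_network_channel) zero_mem_D1_set_iff:
  assumes "x1 \<in> C" "x2 \<in> C"
  shows "0 \<in> D1_set E w F x1 x2 \<longleftrightarrow> x1 = x2"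
  unfolding mem_D1_set_iff
  using zero_error weight_zero_iff error_free_distinct assms by auto

context error_linear_channel
begin

sublocale G: group G
  rewrites "carrier G = E" and "\<one>\<^bsub>G\<^esub> = e0"
  using error_group by auto

text \<open>Since \<open>h\<close> is a homomorphism, multiplying an error by \<open>z\<close> on
  the right adds \<open>h z\<close> to the output, whatever the codeword, so collisions survive the
  shift. Every later manipulation of errors is an instance of this.\<close>

lemma transfer_shift:
  assumes "x1 \<in> C" "x2 \<in> C" "z1 \<in> E" "z2 \<in> E" "z \<in> E" "F x1 z1 = F x2 z2"
  shows "F x1 (z1 \<otimes>\<^bsub>G\<^esub> z) = F x2 (z2 \<otimes>\<^bsub>G\<^esub> z)"
proof -
  interpret A: comm_group A by (rule output_group)
  obtain f h where f: "f \<in> C \<rightarrow> carrier A" and h: "h \<in> hom G A"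
    and F: "\<And>x z. x \<in> C \<Longrightarrow> z \<in> E \<Longrightarrow> F x z = f x \<otimes>\<^bsub>A\<^esub> h z"
    using transfer_linear by blast
  have shift: "F x (z' \<otimes>\<^bsub>G\<^esub> z) = F x z' \<otimes>\<^bsub>A\<^esub> h z" if "x \<in> C" "z' \<in> E" for x z'
  proof -
    have "h (z' \<otimes>\<^bsub>G\<^esub> z) = h z' \<otimes>\<^bsub>A\<^esub> h z" "h z' \<in> carrier A" "h z \<in> carrier A" "f x \<in> carrier A"
      using that assms(5) f h error_group(2) by (auto simp: hom_def)
    then show ?thesis
      using that assms(5) by (simp add: F A.m_assoc)
  qed
  show ?thesis
    using assms by (simp add: shift)
qed

lemma D2_set_subset_D1_set:
  assumes "x1 \<in> C" "x2 \<in> C"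
  shows "D2_set E w F x1 x2 \<subseteq> D1_set E w F x1 x2"
proof
  fix c assume "c \<in> D2_set E w F x1 x2"
  then obtain c1 c2 z1 z2 where c: "c = c1 + c2" and z: "z1 \<in> E" "z2 \<in> E"
    and le: "w z1 \<le> c1" "w z2 \<le> c2" and eq: "F x1 z1 = F x2 z2"
    unfolding D2_set_def mem_Collect_eq ball_Int_nonempty_iff by blast
  have "F x1 e0 = F x2 (z2 \<otimes>\<^bsub>G\<^esub> inv\<^bsub>G\<^esub> z1)"
    using transfer_shift[OF assms z G.inv_closed[OF z(1)] eq] z by simp
  moreover have "w (z2 \<otimes>\<^bsub>G\<^esub> inv\<^bsub>G\<^esub> z1) \<le> c"
    using weight_subadditive[OF z(2) G.inv_closed[OF z(1)]] weight_inv[OF z(1)] le c by simp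
  ultimately show "c \<in> D1_set E w F x1 x2"
    unfolding mem_D1_set_iff using z by blast
qed

lemma D1_set_subset_D0_set:
  assumes "x1 \<in> C" "x2 \<in> C"
  shows "D1_set E w F x1 x2 \<subseteq> D0_set E w F x1 x2"
proof
  fix c assume "c \<in> D1_set E w F x1 x2"
  then obtain z where z: "z \<in> E" "w z \<le> c" and eq: "F x1 e0 = F x2 z"
    unfolding mem_D1_set_iff by blast
  \<comment> \<open>Rounding down here and up in \<open>c2\<close> makes the radii sum to exactly
    \<open>c\<close> and differ by at most one.\<close>
  define c1 where "c1 = c div 2"
  define c2 where "c2 = c - c1"
  \<comment> \<open>The weight of \<open>z\<close> may be smaller than \<open>c\<close>, so it is
    split greedily: as much as fits goes into \<open>a1\<close>, and the rest is at most
    \<open>c - c1\<close>.\<close>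
  obtain a1 a2 where a: "a2 + a1 = w z" "a1 \<le> c1" "a2 \<le> c2"
  proof
    show "(w z - min (w z) c1) + min (w z) c1 = w z" by simp
    show "min (w z) c1 \<le> c1" by simp
    show "w z - min (w z) c1 \<le> c2" using z(2) by (simp add: c2_def min_def diff_le_mono)
  qed
  obtain z2 z1 where z12: "z2 \<in> E" "z1 \<in> E" "w z2 = a2" "w z1 = a1" "z2 \<otimes>\<^bsub>G\<^esub> z1 = z"
    using weight_split[OF z(1) a(1)] by blast
  \<comment> \<open>Shifts act on the right, so the factor moved over to \<open>x1\<close> must be
    the right one; this is why \<open>z1\<close> comes second in the splitting.\<close>
  have "z \<otimes>\<^bsub>G\<^esub> inv\<^bsub>G\<^esub> z1 = z2"
    using z12 G.inv_solve_right'[of z2 z z1] z(1) by simp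
  then have "F x1 (inv\<^bsub>G\<^esub> z1) = F x2 z2"
    using transfer_shift[OF assms zero_error z(1) G.inv_closed[OF z12(2)] eq] z12(2) by simp
  moreover have "w (inv\<^bsub>G\<^esub> z1) \<le> c1" "w z2 \<le> c2"
    using z12 a weight_inv by auto
  ultimately have "decoding_ball E w F x1 c1 \<inter> decoding_ball E w F x2 c2 \<noteq> {}"
    unfolding ball_Int_nonempty_iff using z12 by blast
  moreover have "c = c1 + c2" "\<bar>int c1 - int c2\<bar> \<le> 1"
    unfolding c1_def c2_def by linarith+
  ultimately show "c \<in> D0_set E w F x1 x2"
    unfolding D0_set_def by blast
qed

lemma distance_sets_eq:
  assumes "x1 \<in> C" "x2 \<in> C"
  shows "D0_set E w F x1 x2 = D1_set E w F x1 x2" "D2_set E w F x1 x2 = D1_set E w F x1 x2"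
  using D0_set_subset_D2_set[of E w F x1 x2] D2_set_subset_D1_set[OF assms]
    D1_set_subset_D0_set[OF assms] by blast+

lemma distances_eq:
  assumes "x1 \<in> C" "x2 \<in> C"
  shows "D0 E w F x1 x2 = D1 E w F x1 x2" "D2 E w F x1 x2 = D1 E w F x1 x2"
  unfolding D0_def D1_def D2_def distance_sets_eq[OF assms] by simp_all

lemma D1_commute:
  assumes "x1 \<in> C" "x2 \<in> C"
  shows "D1 E w F x1 x2 = D1 E w F x2 x1"
  unfolding D1_def
  using distance_sets_eq(2)[OF assms] distance_sets_eq(2)[OF assms(2,1)]
    D2_set_commute[of E w F x1 x2] by simp

text \<open>Shifting the collision of \<open>x2\<close> and \<open>x3\<close> by the error
  \<open>z\<close> that links \<open>x1\<close> to \<open>x2\<close> joins the two links. The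
  composite error is the product of \<open>z'\<close> and \<open>z\<close> in this order, as the
  group need not be abelian.\<close>

lemma add_mem_D1_set:
  assumes "x1 \<in> C" "x2 \<in> C" "x3 \<in> C"
    and "c \<in> D1_set E w F x1 x2" "d \<in> D1_set E w F x2 x3"
  shows "c + d \<in> D1_set E w F x1 x3"
proof -
  obtain z z' where z: "z \<in> E" "w z \<le> c" "F x1 e0 = F x2 z"
    and z': "z' \<in> E" "w z' \<le> d" "F x2 e0 = F x3 z'"
    using assms(4,5) unfolding mem_D1_set_iff by blast
  have "F x1 e0 = F x3 (z' \<otimes>\<^bsub>G\<^esub> z)"
    using transfer_shift[OF assms(2,3) zero_error z'(1) z(1) z'(3)] z by simp
  moreover have "w (z' \<otimes>\<^bsub>G\<^esub> z) \<le> c + d"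
    using weight_subadditive[OF z'(1) z(1)] z(2) z'(2) by simp
  ultimately show ?thesis
    unfolding mem_D1_set_iff using z(1) z'(1) by blast
qed

lemma metric_on_D1:
  assumes "finite_distances C E w F"
  shows "metric_on C (\<lambda>x1 x2. real (D1 E w F x1 x2))"
proof -
  \<comment> \<open>Finiteness of the distances is what makes the value of \<open>LEAST\<close> an
    attained minimum.\<close>
  have mem: "D1 E w F x y \<in> D1_set E w F x y" if "x \<in> C" "y \<in> C" for x y
  proof -
    have "\<exists>c. c \<in> D1_set E w F x y"
      using assms that unfolding finite_distances_def by blast
    then show ?thesis
      unfolding D1_def by (rule LeastI_ex)
  qed
  have le: "D1 E w F x y \<le> c" if "c \<in> D1_set E w F x y" for x y c
    unfolding D1_def using that by (rule Least_le)
  have "D1 E w F x y = 0 \<longleftrightarrow> x = y" if "x \<in> C" "y \<in> C" for x y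
    using mem[OF that] le[of 0 x y] zero_mem_D1_set_iff[OF that] by auto
  moreover have "D1 E w F x t \<le> D1 E w F x y + D1 E w F y t"
    if "x \<in> C" "y \<in> C" "t \<in> C" for x y t
    using that by (intro le add_mem_D1_set[of x y t] mem)
  ultimately show ?thesis
    unfolding metric_on_def using D1_commute by (simp flip: of_nat_add)
qed

end

theorem corollary5p11:
  fixes C :: "'c set" and E :: "'e set" and e0 :: 'e and Y :: "'y set"
    and w :: "'e \<Rightarrow> nat" and F :: "'c \<Rightarrow> 'e \<Rightarrow> 'y"
    and G :: "('e, 'm) monoid_scheme" and A :: "('y, 'n) monoid_scheme"
  assumes "generalized_network_code C E e0 Y w F"
    and "finite_distances C E w F"
    and "error_linear_channel C E e0 Y w F G A"
  shows "(\<forall>x1\<in>C. \<forall>x2\<in>C. D0 E w F x1 x2 = D1 E w F x1 x2 \<and> D1 E w F x1 x2 = D2 E w F x1 x2) \<and>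
    metric_on C (\<lambda>x1 x2. real (D0 E w F x1 x2)) \<and>
    metric_on C (\<lambda>x1 x2. real (D1 E w F x1 x2)) \<and>
    metric_on C (\<lambda>x1 x2. real (D2 E w F x1 x2))"
proof -
  interpret error_linear_channel C E e0 Y w F G A by (rule assms(3))
  \<comment> \<open>The distances are known to agree only on \<open>C\<close>, which suffices
    because \<open>metric_on\<close> evaluates them nowhere else.\<close>
  have "metric_on C (\<lambda>x1 x2. real (D0 E w F x1 x2))" "metric_on C (\<lambda>x1 x2. real (D2 E w F x1 x2))"
    using metric_on_D1[OF assms(2)] by (simp_all add: metric_on_def distances_eq)
  then show ?thesis
    using metric_on_D1[OF assms(2)] distances_eq by simp
qed

end
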